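(* Let $b \in \{2,3\}$, let $n \geq b^2-1$, and let $S$ be a set of $2n$ points in regular wheel configuration in the plane. Then for every positive integer $k \leq \left\lceil \frac{(b-1)n}{b} \right\rceil - (b-2)$ there exist $k$ edge-disjoint non-crossing perfect matchings $F_1, F_2, \ldots, F_k$ on $S$, each having precisely $b$ boundary edges, such that $\bigcup_{i=1}^{k} F_i$ is a triangle-free geometric graph.
   Context: A set $S$ of $m$ points is in regular wheel configuration if $m-1$ of its points are regularly (equally) spaced on a circle $C$ and the remaining point $x$ is the center of $C$. Here $m = 2n$; label the points on $C$ as $v_0, v_1, \ldots, v_{2n-2}$ in cyclic order. A boundary edge is an edge joining two consecutive points $v_i v_{i+1}$ on $C$ (indices modulo $2n-1$). A geometric graph is a graph whose vertices are points in the plane, no three on a common line, and whose edges are straight-line segments joining vertices. Two edges cross if they have a common point that is interior to both of them. A perfect matching on $S$ is a set of segments with endpoints in $S$ such that each point of $S$ is an endpoint of exactly one of them; it is non-crossing if no two of its edges cross. Matchings are edge-disjoint if no two of them have an edge in common. A geometric graph is triangle-free if it contains no complete subgraph on three vertices. *)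

theory Defs
  imports "HOL-Analysis.Analysis"
begin

text \<open>
  The plane is \<^typ>\<open>complex\<close>.  A segment is represented by the set of its two endpoints, and a
  geometric graph by its vertex set together with a set of such segments.
\<close>

definition segments :: "complex set \<Rightarrow> complex set set" where
  "segments S = {{a, b} | a b. a \<in> S \<and> b \<in> S \<and> a \<noteq> b}"

definition geometric_graph :: "complex set \<Rightarrow> complex set set \<Rightarrow> bool" where
  "geometric_graph V E \<longleftrightarrow>
     (\<forall>a\<in>V. \<forall>b\<in>V. \<forall>c\<in>V. a \<noteq> b \<and> b \<noteq> c \<and> a \<noteq> c \<longrightarrow> \<not> collinear {a, b, c}) \<and>
     E \<subseteq> segments V"

definition crossing :: "complex set \<Rightarrow> complex set \<Rightarrow> bool" where
  "crossing e f \<longleftrightarrow>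
     (\<exists>a b c d. e = {a, b} \<and> f = {c, d} \<and> open_segment a b \<inter> open_segment c d \<noteq> {})"

definition perfect_matching :: "complex set \<Rightarrow> complex set set \<Rightarrow> bool" where
  "perfect_matching S M \<longleftrightarrow> M \<subseteq> segments S \<and> (\<forall>p\<in>S. \<exists>!e. e \<in> M \<and> p \<in> e)"

definition non_crossing :: "complex set set \<Rightarrow> bool" where
  "non_crossing M \<longleftrightarrow> (\<forall>e\<in>M. \<forall>f\<in>M. e \<noteq> f \<longrightarrow> \<not> crossing e f)"

definition triangle_free :: "complex set set \<Rightarrow> bool" where
  "triangle_free E \<longleftrightarrow>
     \<not> (\<exists>a b c. a \<noteq> b \<and> b \<noteq> c \<and> a \<noteq> c \<and> {a, b} \<in> E \<and> {b, c} \<in> E \<and> {a, c} \<in> E)"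

text \<open>
  The set \<open>S\<close> of \<open>m\<close> points is in regular wheel configuration with centre \<open>x\<close>, and
  \<open>v 0, \<dots>, v (m - 2)\<close> lists its points on the circle in (counterclockwise) cyclic order,
  starting at an arbitrary one of them.  The values of \<open>v\<close> at other indices are irrelevant.
\<close>

definition regular_wheel :: "nat \<Rightarrow> complex set \<Rightarrow> complex \<Rightarrow> (nat \<Rightarrow> complex) \<Rightarrow> bool" where
  "regular_wheel m S x v \<longleftrightarrow>
     (\<exists>r \<theta>. r > 0 \<and>
        (\<forall>i<m - 1. v i = x + of_real r * cis (\<theta> + 2 * pi * real i / real (m - 1)))) \<and>
     S = insert x (v ` {..<m - 1})"

definition boundary_edges :: "nat \<Rightarrow> (nat \<Rightarrow> complex) \<Rightarrow> complex set set" where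
  "boundary_edges m v = {{v i, v (Suc i mod (m - 1))} | i. i < m - 1}"

end

theory Submission
  imports Defs
begin

text \<open>
  Let \<open>N = 2 n - 1\<close>; the points of the circle are numbered by the integers modulo \<open>N\<close>.

  \<^bold>\<open>One matching.\<close>  Join the centre to the point \<open>i\<close> and cut the remaining \<open>N - 1\<close> points, read
  around the circle from \<open>i\<close>, into consecutive blocks of \<open>2 a\<close>, \<open>2 b\<close> and \<open>2 c\<close> points.  Inside
  each block join the points in nested fashion, first to last, second to second last, and so on.  When
  no size exceeds \<open>n / 2\<close>, every chord has its block on one side and the centre and the point
  \<open>i\<close> on the other, so that nothing crosses (\<open>matching_non_crossing\<close>).  Each non-empty nest
  contributes exactly one boundary edge, its innermost chord (\<open>matching_boundary_edges\<close>).

  \<^bold>\<open>The packing.\<close>  Take \<open>k\<close> rotated copies of a single such matching, with steps of \<open>\<mu>\<close>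
  positions.  The chords of a nest are parallel and \<open>N\<close> is odd, so chords of two copies can
  coincide only if their nests have the same innermost edge; this is a condition on the
  differences between the three nest centres (\<open>matchings_disjoint\<close>).

  \<^bold>\<open>Triangles.\<close>  Every chord spans an odd number of steps, fewer than \<open>N / 2\<close>, along its shorter
  arc.  Parity rules out triangles in which one of these arcs is the union of the other two
  (\<open>ahead_not_transitive\<close>), hence the arcs of a triangle on the circle add up to a full turn
  \<open>N\<close>.  A triangle through the centre needs a chord joining the ends of two spokes.

  For two boundary edges the copies are rotated by single steps and the sizes are as equal as
  possible.  Two of the three chords of a triangle around the centre would belong to copies of the
  same nest, and such chords are not rotated far enough against each other (\<open>packable_two\<close>).  For three boundary edges
  the copies are rotated by steps of two, and the sizes are \<open>(t, t - 1, t)\<close>,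
  \<open>(t - 1, t, t + 1)\<close> or \<open>(t, t + 1, t)\<close> for \<open>n = 3 t\<close>, \<open>3 t + 1\<close>, \<open>3 t + 2\<close>.  The spokes then
  differ by even numbers, or by odd numbers too large for a chord.  For \<open>n = 3 t\<close> no three lengths
  add up to \<open>N\<close>; otherwise two of them have to be \<open>2 t + 1\<close>.  Chords of this length lie in copies of
  a single nest, and two of them with a common end are rotated against each other by \<open>2 t + 1\<close> modulo
  \<open>N\<close>, which is out of reach for the even rotations in use.
\<close>

section \<open>The wheel and the sides of its chords\<close>

locale wheel =
  fixes n :: int and x :: complex and r \<theta> :: real
  assumes n_ge: "n \<ge> 3" and r_pos: "r > 0"
begin

definition N :: int where "N = 2 * n - 1"

text \<open>
  Indexing by all integers instead of \<open>0, \<dots>, N - 1\<close> makes rotations plain additions.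
\<close>
definition rim :: "int \<Rightarrow> complex" where
  "rim e = x + of_real r * cis (\<theta> + 2 * pi * of_int e / of_int N)"

text \<open>
  The signed distance from the line through \<open>rim a\<close> and \<open>rim b\<close>: the direction of \<open>(a + b) / 2\<close>
  is normal to the chord, and the chord has distance \<open>r cos (\<pi> (b - a) / N)\<close> from the centre.
  For \<open>a < b < a + N\<close> it is positive on the arc that runs counterclockwise from \<open>a\<close> to \<open>b\<close>.
  Non-crossing and general position both reduce to its sign.
\<close>
definition side :: "int \<Rightarrow> int \<Rightarrow> complex \<Rightarrow> real" where
  "side a b z = Re ((z - x) * cis (- (\<theta> + pi * of_int (a + b) / of_int N)))
                - r * cos (pi * of_int (b - a) / of_int N)"

lemma N_pos: "real_of_int N > 0"
  using n_ge by (simp add: N_def)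

lemma side_rim:
  "side a b (rim e) =
     r * (cos (pi * of_int (2 * e - a - b) / of_int N) - cos (pi * of_int (b - a) / of_int N))"
proof -
  have "(rim e - x) * cis (- (\<theta> + pi * of_int (a + b) / of_int N))
      = of_real r * cis (\<theta> + 2 * pi * of_int e / of_int N - (\<theta> + pi * of_int (a + b) / of_int N))"
    unfolding rim_def by (simp add: cis_mult mult.assoc)
  also have "\<theta> + 2 * pi * of_int e / of_int N - (\<theta> + pi * of_int (a + b) / of_int N)
      = pi * of_int (2 * e - a - b) / of_int N"
    using N_pos by (simp add: field_simps)
  finally show ?thesis
    unfolding side_def by (simp add: algebra_simps)
qed

lemma side_center: "side a b x = - r * cos (pi * of_int (b - a) / of_int N)"
  unfolding side_def by simp

lemma side_ends: "side a b (rim a) = 0" "side a b (rim b) = 0"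
proof -
  have "pi * of_int (2 * a - a - b) / of_int N = - (pi * of_int (b - a) / of_int N)"
    by (simp add: diff_divide_distrib right_diff_distrib)
  then show "side a b (rim a) = 0"
    unfolding side_rim by (simp only: cos_minus) simp
  show "side a b (rim b) = 0"
    unfolding side_rim by simp
qed

lemma side_segment:
  assumes "z \<in> open_segment p q"
  obtains u where "0 < u" "u < 1" "side a b z = (1 - u) * side a b p + u * side a b q"
proof -
  obtain u where u: "0 < u" "u < 1" "z = (1 - u) *\<^sub>R p + u *\<^sub>R q"
    using assms by (auto simp: in_segment)
  have "side a b z = (1 - u) * side a b p + u * side a b q"
    unfolding side_def u(3) by (simp add: algebra_simps)
  with u that show ?thesis by blast
qed

lemma side_inner_pos:
  assumes "a < e" "e < b" "b \<le> a + N"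
  shows "side a b (rim e) > 0"
proof -
  have "cos (pi * of_int (b - a) / of_int N) < cos \<bar>pi * of_int (2 * e - a - b) / of_int N\<bar>"
  proof (rule cos_monotone_0_pi)
    have "\<bar>2 * e - a - b\<bar> < b - a"
      using assms by linarith
    then have "\<bar>real_of_int (2 * e - a - b)\<bar> < real_of_int (b - a)"
      by linarith
    then show "\<bar>pi * of_int (2 * e - a - b) / of_int N\<bar> < pi * of_int (b - a) / of_int N"
      using N_pos by (simp only: abs_mult abs_divide abs_of_pos pi_gt_zero) (simp add: divide_strict_right_mono)
    have "real_of_int (b - a) \<le> real_of_int N"
      using assms by linarith
    then show "pi * of_int (b - a) / of_int N \<le> pi"
      using N_pos by (simp only: pos_divide_le_eq mult_le_cancel_left_pos pi_gt_zero)
  qed simp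
  then show ?thesis
    unfolding side_rim cos_abs_real using r_pos by simp
qed

lemma side_outer_neg:
  assumes "a < b" "b < e" "e < a + N"
  shows "side a b (rim e) < 0"
proof -
  have *: "real_of_int (b - a) < real_of_int (2 * e - a - b)"
    using assms by linarith
  have "cos (pi * of_int (2 * e - a - b) / of_int N) < cos (pi * of_int (b - a) / of_int N)"
  proof (cases "2 * e - a - b \<le> N")
    case True
    show ?thesis
    proof (rule cos_monotone_0_pi)
      show "0 \<le> pi * of_int (b - a) / of_int N"
        using assms N_pos by simp
      show "pi * of_int (b - a) / of_int N < pi * of_int (2 * e - a - b) / of_int N"
        using * N_pos by (simp add: divide_strict_right_mono)
      have "real_of_int (2 * e - a - b) \<le> real_of_int N"
        using True by linarith
      then show "pi * of_int (2 * e - a - b) / of_int N \<le> pi"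
        using N_pos by (simp only: pos_divide_le_eq mult_le_cancel_left_pos pi_gt_zero)
    qed
  next
    case False
    have "cos (pi * of_int (2 * e - a - b) / of_int N)
        = cos (2 * pi - pi * of_int (2 * e - a - b) / of_int N)"
      by (simp add: cos_diff)
    also have "2 * pi - pi * of_int (2 * e - a - b) / of_int N
        = pi * of_int (2 * N - (2 * e - a - b)) / of_int N"
      using N_pos by (simp add: field_simps)
    also have "cos (pi * of_int (2 * N - (2 * e - a - b)) / of_int N)
        < cos (pi * of_int (b - a) / of_int N)"
    proof (rule cos_monotone_0_pi)
      show "0 \<le> pi * of_int (b - a) / of_int N"
        using assms N_pos by simp
      have "real_of_int (b - a) < of_int (2 * N - (2 * e - a - b))"
        using assms by linarith
      then show "pi * of_int (b - a) / of_int N < pi * of_int (2 * N - (2 * e - a - b)) / of_int N"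
        using N_pos by (simp add: divide_strict_right_mono)
      have "real_of_int (2 * N - (2 * e - a - b)) \<le> real_of_int N"
        using False by linarith
      then show "pi * of_int (2 * N - (2 * e - a - b)) / of_int N \<le> pi"
        using N_pos by (simp only: pos_divide_le_eq mult_le_cancel_left_pos pi_gt_zero)
    qed
    finally show ?thesis .
  qed
  then show ?thesis
    unfolding side_rim using r_pos by (simp add: mult_less_0_iff)
qed

lemma side_center_neg:
  assumes "a < b" "2 * (b - a) < N"
  shows "side a b x < 0"
proof -
  have "2 * real_of_int (b - a) < real_of_int N"
    using assms by linarith
  then have "pi * (2 * real_of_int (b - a)) < pi * real_of_int N"
    by (simp only: mult_less_cancel_left_pos pi_gt_zero)
  then have "pi * of_int (b - a) / of_int N < pi / 2"
    using N_pos by (simp add: field_simps)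
  moreover have "pi * of_int (b - a) / of_int N > 0"
    using assms N_pos by simp
  ultimately have "cos (pi * of_int (b - a) / of_int N) > 0"
    by (intro cos_gt_zero) auto
  then show ?thesis
    unfolding side_center using r_pos by simp
qed

lemma rim_neq_center: "rim e \<noteq> x"
  unfolding rim_def using r_pos by simp

lemma rim_eq_iff: "rim a = rim b \<longleftrightarrow> N dvd a - b"
proof
  assume "rim a = rim b"
  then have "cis (\<theta> + 2 * pi * of_int a / of_int N) = cis (\<theta> + 2 * pi * of_int b / of_int N)"
    unfolding rim_def using r_pos by simp
  then obtain m :: int where
    "\<theta> + 2 * pi * of_int a / of_int N = \<theta> + 2 * pi * of_int b / of_int N + 2 * pi * of_int m"
    by (metis cis.sel sin_cos_eq_iff)
  then have "2 * pi * real_of_int (a - b) = 2 * pi * (real_of_int N * of_int m)"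
    using N_pos by (simp add: field_simps)
  then have "real_of_int (a - b) = real_of_int (N * m)"
    by simp
  then have "a - b = N * m"
    by (simp only: of_int_eq_iff)
  then show "N dvd a - b" by simp
next
  assume "N dvd a - b"
  then obtain m where "a = b + N * m"
    by (metis add.commute diff_add_cancel dvdE)
  then have "\<theta> + 2 * pi * of_int a / of_int N
      = \<theta> + 2 * pi * of_int b / of_int N + 2 * pi * of_int m"
    using N_pos by (simp add: field_simps)
  then show "rim a = rim b"
    unfolding rim_def by (simp only: cis_mult [symmetric]) simp
qed

lemma rim_mod: "rim (e mod N) = rim e"
  by (simp add: rim_eq_iff mod_eq_dvd_iff [symmetric])


lemma rim_eq_near: "\<bar>a - b\<bar> < N \<Longrightarrow> rim a = rim b \<longleftrightarrow> a = b"
  unfolding rim_eq_iff by (auto dest: zdvd_imp_le) (smt (verit) zdvd_not_zless dvd_minus_iff)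

lemma crossing_doubleton:
  "crossing {p, q} {s, t} \<longleftrightarrow> open_segment p q \<inter> open_segment s t \<noteq> {}"
proof
  assume "crossing {p, q} {s, t}"
  then show "open_segment p q \<inter> open_segment s t \<noteq> {}"
    unfolding crossing_def doubleton_eq_iff by (metis open_segment_commute)
qed (use crossing_def in blast)

text \<open>
  The open chord lies on the line \<open>side a b z = 0\<close>, whereas a segment with both ends strictly on one
  side of the line stays there.
\<close>
lemma not_crossing_same_side:
  assumes "side a b s > 0 \<and> side a b t > 0 \<or> side a b s < 0 \<and> side a b t < 0"
  shows "\<not> crossing {rim a, rim b} {s, t}" "\<not> crossing {s, t} {rim a, rim b}"
proof -
  have "open_segment (rim a) (rim b) \<inter> open_segment s t = {}"
  proof (rule equals0I)
    fix z assume z: "z \<in> open_segment (rim a) (rim b) \<inter> open_segment s t"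
    from z obtain u where "0 < u" "u < 1" "side a b z = (1 - u) * side a b s + u * side a b t"
      by (auto elim: side_segment)
    moreover from z obtain u' where "side a b z = (1 - u') * side a b (rim a) + u' * side a b (rim b)"
      by (auto elim: side_segment)
    ultimately have eq: "(1 - u) * side a b s + u * side a b t = 0" and u: "0 < 1 - u" "0 < u"
      by (simp_all add: side_ends)
    from assms show False
    proof
      assume "side a b s > 0 \<and> side a b t > 0"
      then have "(1 - u) * side a b s > 0" "u * side a b t > 0"
        using u by (simp_all only: mult_pos_pos)
      then show False using eq by linarith
    next
      assume "side a b s < 0 \<and> side a b t < 0"
      then have "(1 - u) * side a b s < 0" "u * side a b t < 0"
        using u by (simp_all only: mult_pos_neg)
      then show False using eq by linarith
    qed
  qed
  then show "\<not> crossing {rim a, rim b} {s, t}" "\<not> crossing {s, t} {rim a, rim b}"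
    by (auto simp: crossing_doubleton)
qed

lemma not_collinear_side:
  assumes "rim a \<noteq> rim b" "side a b s \<noteq> 0"
  shows "\<not> collinear {rim a, rim b, s}"
proof
  assume "collinear {rim a, rim b, s}"
  then have "collinear {rim a, s, rim b}" by (simp add: insert_commute)
  then obtain u where s: "s = u *\<^sub>R rim a + (1 - u) *\<^sub>R rim b"
    using assms(1) by (auto simp: collinear_3_expand)
  have "side a b s = u * side a b (rim a) + (1 - u) * side a b (rim b)"
    unfolding s side_def by (simp add: algebra_simps)
  then show False
    using assms(2) by (simp add: side_ends)
qed

abbreviation points :: "complex set" where "points \<equiv> insert x (range rim)"

lemma not_collinear_rim:
  assumes "rim a \<noteq> rim b" "rim b \<noteq> rim c" "rim a \<noteq> rim c"
  shows "\<not> collinear {rim a, rim b, rim c}"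
proof -
  have N: "N > 0" using N_pos by simp
  define p where "p = a + (b - a) mod N"
  define q where "q = a + (c - a) mod N"
  have rims: "rim p = rim b" "rim q = rim c"
    unfolding p_def q_def rim_eq_iff by (simp_all add: mod_eq_dvd_iff [symmetric] mod_add_right_eq)
  have "p \<noteq> a" "q \<noteq> a" "p \<noteq> q" "p \<ge> a" "q \<ge> a" "p < a + N" "q < a + N"
    using assms rims N by (auto simp: p_def q_def)
  then consider "a < p" "p < q" | "a < q" "q < p" by linarith
  then show ?thesis
  proof cases
    case 1
    then have "side a p (rim q) < 0"
      using \<open>q < a + N\<close> by (intro side_outer_neg)
    then show ?thesis
      using not_collinear_side [of a p "rim q"] assms rims by simp
  next
    case 2
    then have "side a p (rim q) > 0"
      using \<open>p < a + N\<close> by (intro side_inner_pos) auto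
    then show ?thesis
      using not_collinear_side [of a p "rim q"] assms rims by simp
  qed
qed

text \<open>
  As \<open>N\<close> is odd, no two points of the circle are antipodal; so one of the two arcs between them
  is shorter than a half turn, and the centre lies strictly on the far side of the chord.
\<close>
lemma not_collinear_center:
  assumes "rim a \<noteq> rim b"
  shows "\<not> collinear {rim a, rim b, x}"
proof -
  have N: "N > 0" "odd N" using N_pos by (simp_all add: N_def)
  define p where "p = a + (b - a) mod N"
  have rims: "rim p = rim b"
    unfolding p_def rim_eq_iff by (simp_all add: mod_eq_dvd_iff [symmetric] mod_add_right_eq)
  have p: "p \<noteq> a" "p \<ge> a" "p < a + N"
    using assms rims N by (auto simp: p_def)
  have "2 * (p - a) \<noteq> N" using N(2) by (metis dvd_triv_left)
  then have "2 * (p - a) < N \<or> 2 * (a + N - p) < N" by presburger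
  then consider "2 * (p - a) < N" | "2 * (a + N - p) < N" by blast
  then show ?thesis
  proof cases
    case 1
    then have "side a p x < 0"
      using p by (intro side_center_neg) auto
    then show ?thesis
      using not_collinear_side [of a p x] assms rims by simp
  next
    case 2
    then have "side p (a + N) x < 0"
      using p by (intro side_center_neg) auto
    moreover have "rim (a + N) = rim a" by (simp add: rim_eq_iff)
    ultimately show ?thesis
      using not_collinear_side [of p "a + N" x] assms rims by (simp add: insert_commute)
  qed
qed

lemma points_general_position:
  assumes "p \<in> points" "q \<in> points" "s \<in> points" "p \<noteq> q" "q \<noteq> s" "p \<noteq> s"
  shows "\<not> collinear {p, q, s}"
  using assms not_collinear_rim not_collinear_center
  by (auto simp: insert_commute)

end

section \<open>Matchings made of three nests of chords\<close>

text \<open>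
  Positions are counted from the end of the spoke.  The chords of one nest are those with a fixed sum
  \<open>p + q\<close>, which is the sum of the first and the last position of its block; the lower bound on
  \<open>p\<close> keeps them inside the block.  A size \<open>0\<close> yields an empty nest, so that matchings with two and
  with three boundary edges are instances of the same construction.
\<close>
definition nested_pairs :: "int \<Rightarrow> int \<Rightarrow> int \<Rightarrow> (int \<times> int) set" where
  "nested_pairs a b c = {(p, q). p < q \<and>
     (0 < p \<and> p + q = 2 * a + 1 \<or>
      2 * a < p \<and> p + q = 4 * a + 2 * b + 1 \<or>
      2 * a + 2 * b < p \<and> p + q = 4 * a + 4 * b + 2 * c + 1)}"

text \<open>
  The bound \<open>2 s \<le> n\<close> on a size \<open>s\<close> says that the outermost chord of the nest, of length
  \<open>2 s - 1\<close>, spans less than a half turn and hence does not separate the centre from the spoke.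
\<close>
locale nests = wheel +
  fixes a b c :: int
  assumes size_pos: "a > 0" "b > 0" "c \<ge> 0"
    and size_sum: "a + b + c = n - 1"
    and size_le: "2 * a \<le> n" "2 * b \<le> n" "2 * c \<le> n"
begin

abbreviation pairs :: "(int \<times> int) set" where "pairs \<equiv> nested_pairs a b c"

lemma pair_bounds:
  assumes "(p, q) \<in> pairs"
  shows "0 < p" "p < q" "q < N" "odd (q - p)" "2 * (q - p) < N"
proof -
  show "0 < p" "p < q" "q < N" "2 * (q - p) < N"
    using assms size_pos size_sum size_le by (auto simp: nested_pairs_def N_def)
  have "p + q = 2 * a + 1 \<or> p + q = 2 * (2 * a + b) + 1 \<or> p + q = 2 * (2 * a + 2 * b + c) + 1"
    using assms by (auto simp: nested_pairs_def)
  then have "odd (p + q)" by (metis even_plus_one_iff dvd_triv_left)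
  then show "odd (q - p)" by simp
qed

definition partner :: "int \<Rightarrow> int" where
  "partner p = (if p \<le> 2 * a then 2 * a + 1 - p
     else if p \<le> 2 * a + 2 * b then 4 * a + 2 * b + 1 - p
     else 4 * a + 4 * b + 2 * c + 1 - p)"

lemma pairs_partner:
  assumes "0 < p" "p < N"
  shows "(p, q) \<in> pairs \<or> (q, p) \<in> pairs \<longleftrightarrow> q = partner p"
proof
  assume "(p, q) \<in> pairs \<or> (q, p) \<in> pairs"
  then show "q = partner p"
    using size_pos unfolding partner_def nested_pairs_def mem_Collect_eq case_prod_conv
    by (elim disjE conjE; cases "p \<le> 2 * a"; cases "p \<le> 2 * a + 2 * b"; simp)
next
  assume q: "q = partner p"
  have "q \<noteq> p" unfolding q partner_def by presburger
  then show "(p, q) \<in> pairs \<or> (q, p) \<in> pairs"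
    using assms size_pos size_sum q
    unfolding partner_def nested_pairs_def mem_Collect_eq case_prod_conv N_def
    by (cases "p < q"; cases "p \<le> 2 * a"; cases "p \<le> 2 * a + 2 * b"; simp)
qed

lemma pairs_laminar:
  assumes "(p, q) \<in> pairs" "(p', q') \<in> pairs" "(p, q) \<noteq> (p', q')"
  shows "p < p' \<and> p' < q \<and> p < q' \<and> q' < q \<or>
    (p' < p \<or> q < p') \<and> (q' < p \<or> q < q')"
proof -
  have "p < q" "p' < q'" using assms(1,2) by (auto simp: nested_pairs_def)
  have "p + q = p' + q' \<or> q < p' \<or> q' < p"
    using assms(1,2) size_pos unfolding nested_pairs_def mem_Collect_eq case_prod_conv
    by (elim conjE disjE; linarith)
  then show ?thesis
  proof (elim disjE)
    assume eq: "p + q = p' + q'"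
    then have "p \<noteq> p'" using assms(3) by auto
    then show ?thesis using eq \<open>p < q\<close> \<open>p' < q'\<close> by (cases "p < p'") linarith+
  qed (use \<open>p < q\<close> \<open>p' < q'\<close> in linarith)+
qed

definition matching :: "int \<Rightarrow> complex set set" where
  "matching i = insert {x, rim i} {{rim (i + p), rim (i + q)} | p q. (p, q) \<in> pairs}"

lemma matching_cases:
  assumes "e \<in> matching i"
  obtains (spoke) "e = {x, rim i}"
  | (chord) p q where "e = {rim (i + p), rim (i + q)}" "(p, q) \<in> pairs"
  using assms by (auto simp: matching_def)

lemma matching_perfect: "perfect_matching points (matching i)"
proof -
  have N: "N > 0" using N_pos by simp
  have "matching i \<subseteq> segments points"
  proof
    fix e assume "e \<in> matching i"
    then show "e \<in> segments points"
    proof (cases rule: matching_cases)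
      case spoke
      then show ?thesis
        using rim_neq_center [of i] unfolding segments_def by blast
    next
      case (chord p q)
      then have "rim (i + p) \<noteq> rim (i + q)"
        using pair_bounds [of p q] by (subst rim_eq_near) auto
      then show ?thesis
        using chord unfolding segments_def by blast
    qed
  qed
  moreover have "\<exists>!e. e \<in> matching i \<and> z \<in> e" if z: "z \<in> points" for z
  proof -
    \<comment> \<open>A point of the circle other than \<open>rim i\<close> has a unique position between \<open>1\<close> and \<open>N - 1\<close>.\<close>
    consider "z = x" | "z = rim i" | p where "z = rim (i + p)" "0 < p" "p < N"
    proof -
      have "\<exists>p. z = rim (i + p) \<and> 0 \<le> p \<and> p < N" if "z \<noteq> x"
      proof -
        obtain y where "z = rim y" using z \<open>z \<noteq> x\<close> by auto
        moreover have "rim (i + (y - i) mod N) = rim y"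
          unfolding rim_eq_iff by (simp add: mod_eq_dvd_iff [symmetric] mod_add_right_eq)
        moreover have "0 \<le> (y - i) mod N" "(y - i) mod N < N" using N by simp_all
        ultimately show ?thesis by metis
      qed
      then show thesis using that by (metis add.right_neutral order_le_less)
    qed
    then show ?thesis
    proof cases
      case 1
      show ?thesis
      proof (rule ex1I [of _ "{x, rim i}"])
        show "{x, rim i} \<in> matching i \<and> z \<in> {x, rim i}"
          using 1 by (simp add: matching_def)
        fix e assume "e \<in> matching i \<and> z \<in> e"
        then show "e = {x, rim i}"
          using 1 rim_neq_center [symmetric] by (auto simp: matching_def)
      qed
    next
      case 2
      show ?thesis
      proof (rule ex1I [of _ "{x, rim i}"])
        show "{x, rim i} \<in> matching i \<and> z \<in> {x, rim i}"
          using 2 by (simp add: matching_def)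
        fix e assume e: "e \<in> matching i \<and> z \<in> e"
        then have "e \<in> matching i" by simp
        then show "e = {x, rim i}"
        proof (cases rule: matching_cases)
          case (chord p q)
          then show ?thesis
            using e 2 pair_bounds [of p q] rim_eq_near [of i "i + p"] rim_eq_near [of i "i + q"]
            by auto
        qed
      qed
    next
      case (3 p)
      show ?thesis
      proof (rule ex1I [of _ "{rim (i + p), rim (i + partner p)}"])
        have "(p, partner p) \<in> pairs \<or> (partner p, p) \<in> pairs"
          using 3 pairs_partner by blast
        then show "{rim (i + p), rim (i + partner p)} \<in> matching i
            \<and> z \<in> {rim (i + p), rim (i + partner p)}"
          using 3 by (auto simp: matching_def insert_commute)
        fix e assume e: "e \<in> matching i \<and> z \<in> e"
        then have "e \<in> matching i" by simp
        then show "e = {rim (i + p), rim (i + partner p)}"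
        proof (cases rule: matching_cases)
          case spoke
          then show ?thesis
            using e 3 rim_neq_center rim_eq_near [of "i + p" i] by auto
        next
          case (chord p' q')
          then have "rim (i + p) = rim (i + p') \<or> rim (i + p) = rim (i + q')"
            using e 3 by auto
          then have "p = p' \<or> p = q'"
            using 3 pair_bounds [of p' q'] chord rim_eq_near [of "i + p" "i + p'"]
              rim_eq_near [of "i + p" "i + q'"] by auto
          then show ?thesis
            using chord 3 pairs_partner [of p p'] pairs_partner [of p q'] by (auto simp: insert_commute)
        qed
      qed
    qed
  qed
  ultimately show ?thesis
    unfolding perfect_matching_def by blast
qed

text \<open>
  The line through a chord has all other edges of its matching strictly on one of its two sides: the
  chords nested inside it lie on the inner side, all other chords and the spoke on the outer side,
  together with the centre.
\<close>
lemma chord_not_crossing: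
  assumes "(p, q) \<in> pairs" "e \<in> matching i" "e \<noteq> {rim (i + p), rim (i + q)}"
  shows "\<not> crossing {rim (i + p), rim (i + q)} e" "\<not> crossing e {rim (i + p), rim (i + q)}"
proof -
  note pq = pair_bounds [OF assms(1)]
  have inner: "side (i + p) (i + q) (rim (i + y)) > 0" if "p < y" "y < q" for y
    using that pq by (intro side_inner_pos) auto
  have outer: "side (i + p) (i + q) (rim (i + y)) < 0" if "y < p \<or> q < y" "0 \<le> y" "y < N" for y
  proof (cases "q < y")
    case True
    then show ?thesis using that pq by (intro side_outer_neg) auto
  next
    case False
    \<comment> \<open>Positions before \<open>p\<close> lie beyond \<open>q\<close> after a full turn.\<close>
    have "side (i + p) (i + q) (rim (i + y + N)) < 0"
      using False that pq by (intro side_outer_neg) auto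
    moreover have "rim (i + y + N) = rim (i + y)" by (simp add: rim_eq_iff)
    ultimately show ?thesis by simp
  qed
  have "\<exists>s t. e = {s, t} \<and> (side (i + p) (i + q) s > 0 \<and> side (i + p) (i + q) t > 0 \<or>
      side (i + p) (i + q) s < 0 \<and> side (i + p) (i + q) t < 0)"
    using assms(2)
  proof (cases rule: matching_cases)
    case spoke
    have "side (i + p) (i + q) (rim i) < 0"
      using outer [of 0] pq by simp
    moreover have "side (i + p) (i + q) x < 0"
      using pq by (intro side_center_neg) auto
    ultimately show ?thesis using spoke by blast
  next
    case (chord p' q')
    note pq' = pair_bounds [OF chord(2)]
    have "(p, q) \<noteq> (p', q')" using chord assms(3) by auto
    from pairs_laminar [OF assms(1) chord(2) this]
    have "side (i + p) (i + q) (rim (i + p')) > 0 \<and> side (i + p) (i + q) (rim (i + q')) > 0 \<or>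
      side (i + p) (i + q) (rim (i + p')) < 0 \<and> side (i + p) (i + q) (rim (i + q')) < 0"
      using inner outer pq' by auto
    then show ?thesis using chord by blast
  qed
  then show "\<not> crossing {rim (i + p), rim (i + q)} e" "\<not> crossing e {rim (i + p), rim (i + q)}"
    using not_crossing_same_side by blast+
qed

lemma matching_non_crossing: "non_crossing (matching i)"
  unfolding non_crossing_def
proof (intro ballI impI)
  fix e f assume e: "e \<in> matching i" and f: "f \<in> matching i" and "e \<noteq> f"
  from e show "\<not> crossing e f"
  proof (cases rule: matching_cases)
    case spoke
    from f show ?thesis
    proof (cases rule: matching_cases)
      case (chord p q)
      then show ?thesis using chord_not_crossing e \<open>e \<noteq> f\<close> by blast
    qed (use spoke \<open>e \<noteq> f\<close> in simp)
  next
    case (chord p q)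
    then show ?thesis using chord_not_crossing f \<open>e \<noteq> f\<close> by blast
  qed
qed

text \<open>
  The boundary edge of a nest joins the positions \<open>s\<close> and \<open>s + 1\<close> for some \<open>s\<close> in this set, and
  \<open>2 s + 1\<close> is the position sum shared by all chords of the nest.
\<close>
definition centers :: "int set" where
  "centers = {a, 2 * a + b} \<union> (if c = 0 then {} else {2 * a + 2 * b + c})"

lemma pair_center:
  assumes "(p, q) \<in> pairs"
  obtains s where "s \<in> centers" "p + q = 2 * s + 1"
proof -
  have "p + q = 2 * a + 1 \<or> p + q = 2 * (2 * a + b) + 1 \<or>
      c \<noteq> 0 \<and> p + q = 2 * (2 * a + 2 * b + c) + 1"
    using assms unfolding nested_pairs_def by auto
  moreover have "a \<in> centers" "2 * a + b \<in> centers" "c \<noteq> 0 \<Longrightarrow> 2 * a + 2 * b + c \<in> centers"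
    unfolding centers_def by auto
  ultimately show ?thesis
    using that by blast
qed

lemma centers_bounds: "s \<in> centers \<Longrightarrow> 0 < s \<and> s + 1 < N"
  using size_pos size_sum unfolding centers_def N_def by (auto split: if_splits)

lemma center_pair: "(s, s + 1) \<in> pairs \<longleftrightarrow> s \<in> centers"
  using size_pos unfolding nested_pairs_def centers_def by (auto split: if_splits)

lemma card_centers: "card centers = (if c = 0 then 2 else 3)"
  using size_pos unfolding centers_def by auto

lemma matching_boundary_edges:
  "card (matching i \<inter> {{rim e, rim (e + 1)} | e. True}) = (if c = 0 then 2 else 3)"
proof -
  let ?f = "\<lambda>s. {rim (i + s), rim (i + s + 1)}"
  have "matching i \<inter> {{rim e, rim (e + 1)} | e. True} = ?f ` centers"
  proof (intro equalityI subsetI)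
    fix e assume "e \<in> matching i \<inter> {{rim e, rim (e + 1)} | e. True}"
    then obtain y where e: "e \<in> matching i" "e = {rim y, rim (y + 1)}" by auto
    from e(1) show "e \<in> ?f ` centers"
    proof (cases rule: matching_cases)
      case spoke
      then show ?thesis using e rim_neq_center by (auto simp: doubleton_eq_iff)
    next
      case (chord p q)
      note pq = pair_bounds [OF chord(2)]
      have "rim y = rim (i + p) \<and> rim (y + 1) = rim (i + q) \<or>
          rim y = rim (i + q) \<and> rim (y + 1) = rim (i + p)"
        using e(2) chord(1) by (auto simp: doubleton_eq_iff)
      then have "N dvd q - p - 1 \<or> N dvd q - p + 1"
      proof (elim disjE conjE)
        assume "rim y = rim (i + p)" "rim (y + 1) = rim (i + q)"
        then have "N dvd (y - (i + p)) - (y + 1 - (i + q))"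
          using rim_eq_iff dvd_diff by blast
        then show ?thesis by (simp add: algebra_simps)
      next
        assume "rim y = rim (i + q)" "rim (y + 1) = rim (i + p)"
        then have "N dvd (y + 1 - (i + p)) - (y - (i + q))"
          using rim_eq_iff dvd_diff by blast
        then show ?thesis by (simp add: algebra_simps)
      qed
      then have "q = p + 1"
        using pq n_ge by (auto simp: N_def dest!: zdvd_imp_le)
      then show ?thesis
        using chord center_pair by (auto simp: add.assoc)
    qed
  next
    fix e assume "e \<in> ?f ` centers"
    then show "e \<in> matching i \<inter> {{rim e, rim (e + 1)} | e. True}"
      using center_pair unfolding matching_def by (fastforce simp: add.assoc)
  qed
  moreover have "inj_on ?f centers"
  proof (rule inj_onI)
    fix s t assume st: "s \<in> centers" "t \<in> centers" "?f s = ?f t"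
    then have "rim (i + s) = rim (i + t) \<or>
        rim (i + s) = rim (i + t + 1) \<and> rim (i + s + 1) = rim (i + t)"
      by (auto simp: doubleton_eq_iff)
    then show "s = t"
      using centers_bounds [OF st(1)] centers_bounds [OF st(2)]
      by (auto simp: rim_eq_near)
  qed
  ultimately show ?thesis
    by (simp add: card_image card_centers)
qed


section \<open>Unions of rotated matchings\<close>

text \<open>
  The sum of the indices of the two ends determines, modulo \<open>N\<close>, which nest of which rotation a chord
  can come from: equal chords give \<open>2 (i + s) + 1 \<equiv> 2 (j + t) + 1\<close>, where the factor 2 can be
  cancelled because \<open>N\<close> is odd.  The case \<open>s = t\<close> of the hypothesis separates the spokes.
\<close>
lemma matchings_disjoint:
  assumes "\<And>s t. s \<in> centers \<Longrightarrow> t \<in> centers \<Longrightarrow> \<not> N dvd i - j + s - t"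
  shows "matching i \<inter> matching j = {}"
proof (rule equals0I)
  fix e assume "e \<in> matching i \<inter> matching j"
  then have e: "e \<in> matching i" "e \<in> matching j" by simp_all
  from e(1) show False
  proof (cases rule: matching_cases)
    case spoke
    from e(2) show False
    proof (cases rule: matching_cases)
      case spoke
      then have "rim i = rim j"
        using \<open>e = {x, rim i}\<close> by (auto simp: doubleton_eq_iff)
      then have "N dvd i - j + a - a"
        by (simp add: rim_eq_iff)
      then show False
        using assms [of a a] by (auto simp: centers_def)
    next
      case (chord p q)
      then have "{rim (j + p), rim (j + q)} = {x, rim i}" using spoke by simp
      then show False
        using rim_neq_center unfolding doubleton_eq_iff by metis
    qed
  next
    case (chord p q)
    from e(2) show False
    proof (cases rule: matching_cases)
      case spoke
      then show False
        using chord rim_neq_center by (auto simp: doubleton_eq_iff)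
    next
      case (chord p' q')
      obtain s where s: "s \<in> centers" "p + q = 2 * s + 1"
        using pair_center \<open>(p, q) \<in> pairs\<close> by blast
      obtain t where t: "t \<in> centers" "p' + q' = 2 * t + 1"
        using pair_center \<open>(p', q') \<in> pairs\<close> by blast
      have "rim (i + p) = rim (j + p') \<and> rim (i + q) = rim (j + q') \<or>
          rim (i + p) = rim (j + q') \<and> rim (i + q) = rim (j + p')"
        using chord(1) \<open>e = {rim (i + p), rim (i + q)}\<close> by (auto simp: doubleton_eq_iff)
      then have "N dvd ((i + p) - (j + p')) + ((i + q) - (j + q')) \<or>
          N dvd ((i + p) - (j + q')) + ((i + q) - (j + p'))"
        using rim_eq_iff dvd_add by blast
      moreover have "((i + p) - (j + p')) + ((i + q) - (j + q')) = 2 * (i - j + s - t)"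
        "((i + p) - (j + q')) + ((i + q) - (j + p')) = 2 * (i - j + s - t)"
        using s(2) t(2) by algebra+
      ultimately have "N dvd 2 * (i - j + s - t)" by metis
      moreover have "coprime N 2" unfolding N_def by simp
      ultimately have "N dvd i - j + s - t"
        using coprime_dvd_mult_right_iff by blast
      then show False
        using assms s t by blast
    qed
  qed
qed

text \<open>
  Orients the chords of the union: \<open>z\<close> is reached from \<open>y\<close> counterclockwise along the shorter arc of
  a chord.
\<close>
definition ahead :: "int set \<Rightarrow> int \<Rightarrow> int \<Rightarrow> bool" where
  "ahead I y z \<longleftrightarrow> (\<exists>i\<in>I. \<exists>(p, q)\<in>pairs. N dvd y - (i + p) \<and> N dvd z - (i + q))"

lemma chord_ahead:
  assumes "{rim y, rim z} \<in> (\<Union>i\<in>I. matching i)"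
  shows "ahead I y z \<or> ahead I z y"
proof -
  obtain i where i: "i \<in> I" "{rim y, rim z} \<in> matching i" using assms by auto
  from i(2) show ?thesis
  proof (cases rule: matching_cases)
    case spoke
    then show ?thesis using rim_neq_center by (auto simp: doubleton_eq_iff)
  next
    case (chord p q)
    then show ?thesis
      using i unfolding ahead_def doubleton_eq_iff rim_eq_iff by blast
  qed
qed

lemma spoke_start:
  assumes "{x, rim y} \<in> (\<Union>i\<in>I. matching i)"
  shows "\<exists>i\<in>I. N dvd i - y"
proof -
  obtain i where i: "i \<in> I" "{x, rim y} \<in> matching i" using assms by auto
  from i(2) show ?thesis
  proof (cases rule: matching_cases)
    case spoke
    then have "rim i = rim y" using rim_neq_center by (auto simp: doubleton_eq_iff)
    then show ?thesis using i(1) rim_eq_iff by blast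
  next
    case (chord p q)
    then show ?thesis using rim_neq_center unfolding doubleton_eq_iff by metis
  qed
qed

lemma ahead_length:
  assumes "ahead I y z"
  obtains d where "odd d" "0 < d" "2 * d < N" "N dvd z - y - d"
proof -
  obtain i p q where "(p, q) \<in> pairs" and d: "N dvd y - (i + p)" "N dvd z - (i + q)"
    using assms unfolding ahead_def by blast
  moreover have "N dvd z - y - (q - p)"
    using dvd_diff [OF d(2) d(1)] by (simp add: algebra_simps)
  ultimately show ?thesis
    using that [of "q - p"] pair_bounds [of p q] by auto
qed

text \<open>
  Otherwise \<open>d + d' - d''\<close> would be a multiple of \<open>N\<close> for three odd lengths below \<open>N / 2\<close>; but it is
  odd, hence not \<open>0\<close>, and smaller than \<open>N\<close> in absolute value.
\<close>
lemma ahead_not_transitive: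
  assumes "ahead I y z" "ahead I z u" "ahead I y u"
  shows False
proof -
  obtain d where d: "odd d" "0 < d" "2 * d < N" "N dvd z - y - d"
    using assms(1) by (rule ahead_length)
  obtain d' where d': "odd d'" "0 < d'" "2 * d' < N" "N dvd u - z - d'"
    using assms(2) by (rule ahead_length)
  obtain d'' where d'': "odd d''" "0 < d''" "2 * d'' < N" "N dvd u - y - d''"
    using assms(3) by (rule ahead_length)
  have "N dvd (u - y - d'') - ((u - z - d') + (z - y - d))"
    by (rule dvd_diff [OF d''(4) dvd_add [OF d'(4) d(4)]])
  then have "N dvd d + d' - d''" by (simp add: algebra_simps)
  moreover have "odd (d + d' - d'')" using d d' d'' by simp
  then have "d + d' - d'' \<noteq> 0" by (metis even_zero)
  moreover have "\<bar>d + d' - d''\<bar> < \<bar>N\<bar>" using d d' d'' by linarith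
  ultimately show False
    using dvd_imp_le_int [of "d + d' - d''" N] by linarith
qed

text \<open>
  Without transitive triples, a triangle on the circle is oriented cyclically.  Its arc lengths
  then add up to a positive multiple of \<open>N\<close> below \<open>3 N / 2\<close>, that is, to \<open>N\<close> itself.  The two
  hypotheses exclude the two remaining kinds of triangles: a chord between the ends of two spokes, and
  three chords surrounding the centre.
\<close>
lemma triangle_free_union:
  assumes spokes: "\<And>i i' j p q. i \<in> I \<Longrightarrow> i' \<in> I \<Longrightarrow> j \<in> I \<Longrightarrow> (p, q) \<in> pairs \<Longrightarrow>
      N dvd i - (j + p) \<Longrightarrow> N dvd i' - (j + q) \<Longrightarrow> False"
    and around: "\<And>i p q i' p' q' i'' p'' q''. i \<in> I \<Longrightarrow> i' \<in> I \<Longrightarrow> i'' \<in> I \<Longrightarrow>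
      (p, q) \<in> pairs \<Longrightarrow> (p', q') \<in> pairs \<Longrightarrow> (p'', q'') \<in> pairs \<Longrightarrow>
      (q - p) + (q' - p') + (q'' - p'') = N \<Longrightarrow>
      N dvd (i + q) - (i' + p') \<Longrightarrow> N dvd (i' + q') - (i'' + p'') \<Longrightarrow>
      N dvd (i'' + q'') - (i + p) \<Longrightarrow> False"
  shows "triangle_free (\<Union>i\<in>I. matching i)"
proof -
  let ?E = "\<Union>i\<in>I. matching i"
  have no_spoke: False if "ahead I y z" "N dvd i - y" "N dvd i' - z" "i \<in> I" "i' \<in> I" for y z i i'
  proof -
    obtain j p q where j: "j \<in> I" "(p, q) \<in> pairs" "N dvd y - (j + p)" "N dvd z - (j + q)"
      using \<open>ahead I y z\<close> unfolding ahead_def by blast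
    have "N dvd i - (j + p)" "N dvd i' - (j + q)"
      using dvd_add [OF that(2) j(3)] dvd_add [OF that(3) j(4)] by (simp_all add: algebra_simps)
    then show False
      using spokes that j by blast
  qed
  have no_center: False if E: "{x, rim y} \<in> ?E" "{x, rim z} \<in> ?E" "{rim y, rim z} \<in> ?E" for y z
  proof -
    obtain i i' where "i \<in> I" "N dvd i - y" "i' \<in> I" "N dvd i' - z"
      using spoke_start [OF E(1)] spoke_start [OF E(2)] by blast
    with chord_ahead [OF E(3)] no_spoke [of y z i i'] no_spoke [of z y i' i] show False
      by blast
  qed
  have no_cycle: False if C: "ahead I y z" "ahead I z u" "ahead I u y" for y z u
  proof -
    obtain i p q where i: "i \<in> I" "(p, q) \<in> pairs" "N dvd y - (i + p)" "N dvd z - (i + q)"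
      using C(1) unfolding ahead_def by blast
    obtain i' p' q' where i': "i' \<in> I" "(p', q') \<in> pairs" "N dvd z - (i' + p')" "N dvd u - (i' + q')"
      using C(2) unfolding ahead_def by blast
    obtain i'' p'' q'' where i'': "i'' \<in> I" "(p'', q'') \<in> pairs" "N dvd u - (i'' + p'')" "N dvd y - (i'' + q'')"
      using C(3) unfolding ahead_def by blast
    have joints: "N dvd (z - (i' + p')) - (z - (i + q))" "N dvd (u - (i'' + p'')) - (u - (i' + q'))"
      "N dvd (y - (i + p)) - (y - (i'' + q''))"
      using i i' i'' by (blast intro: dvd_diff)+
    then have "N dvd ((z - (i' + p')) - (z - (i + q))) + ((u - (i'' + p'')) - (u - (i' + q')))
        + ((y - (i + p)) - (y - (i'' + q'')))"
      by (intro dvd_add)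
    then have "N dvd (q - p) + (q' - p') + (q'' - p'')"
      by (simp add: algebra_simps)
    then obtain m where m: "(q - p) + (q' - p') + (q'' - p'') = N * m" ..
    note bounds = pair_bounds [OF i(2)] pair_bounds [OF i'(2)] pair_bounds [OF i''(2)]
    have "N > 0" using N_pos by simp
    have "0 < (q - p) + (q' - p') + (q'' - p'')" "(q - p) + (q' - p') + (q'' - p'') < 2 * N"
      using bounds(2,5,7,10,12,15) \<open>N > 0\<close> by (smt (verit))+
    then have "N * m < N * 2" "N * 0 < N * m"
      unfolding m by (simp_all only: mult.commute mult_zero_right)
    then have "m < 2" "0 < m"
      using \<open>N > 0\<close> by (simp_all only: mult_less_cancel_left_pos)
    then have "(q - p) + (q' - p') + (q'' - p'') = N"
      using m by auto
    then show False
      using around [OF i(1) i'(1) i''(1) i(2) i'(2) i''(2)] joints by (simp add: algebra_simps)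
  qed
  have no_rim: False if C: "{rim y, rim z} \<in> ?E" "{rim z, rim u} \<in> ?E" "{rim y, rim u} \<in> ?E" for y z u
    using chord_ahead [OF C(1)] chord_ahead [OF C(2)] chord_ahead [OF C(3)]
      no_cycle [of y z u] no_cycle [of y u z]
      ahead_not_transitive [of I y z u] ahead_not_transitive [of I y u z]
      ahead_not_transitive [of I z y u] ahead_not_transitive [of I z u y]
      ahead_not_transitive [of I u y z] ahead_not_transitive [of I u z y] by argo
  have "e \<subseteq> points" if "e \<in> ?E" for e
    using that by (auto simp: matching_def)
  then have sub: "p \<in> points \<and> q \<in> points" if "{p, q} \<in> ?E" for p q
    using that by blast
  show ?thesis
    unfolding triangle_free_def
  proof (rule notI, elim exE conjE)
    fix p q s
    assume neq: "p \<noteq> q" "q \<noteq> s" "p \<noteq> s"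
      and E: "{p, q} \<in> ?E" "{q, s} \<in> ?E" "{p, s} \<in> ?E"
    have "p = x \<or> (\<exists>y. p = rim y)" "q = x \<or> (\<exists>y. q = rim y)" "s = x \<or> (\<exists>y. s = rim y)"
      using sub [OF E(1)] sub [OF E(2)] by blast+
    then consider y z where "p = x" "q = rim y" "s = rim z" | y z where "q = x" "p = rim y" "s = rim z"
      | y z where "s = x" "p = rim y" "q = rim z" | y z u where "p = rim y" "q = rim z" "s = rim u"
      using neq by blast
    then show False
    proof cases
      case (1 y z)
      then show False using E no_center [of y z] by blast
    next
      case (2 y z)
      then show False using E no_center [of y z] by (metis insert_commute)
    next
      case (3 y z)
      then show False using E no_center [of y z] by (metis insert_commute)
    next
      case (4 y z u)
      then show False using E no_rim [of y z u] by blast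
    qed
  qed
qed

end

section \<open>Packing rotated copies\<close>

definition (in wheel) packable :: "nat \<Rightarrow> int \<Rightarrow> bool" where
  "packable m k \<longleftrightarrow> (\<exists>F :: int \<Rightarrow> complex set set.
     (\<forall>i\<in>{1..k}. perfect_matching points (F i) \<and> non_crossing (F i) \<and>
        card (F i \<inter> {{rim e, rim (e + 1)} | e. True}) = m) \<and>
     (\<forall>i\<in>{1..k}. \<forall>j\<in>{1..k}. i \<noteq> j \<longrightarrow> F i \<inter> F j = {}) \<and>
     geometric_graph points (\<Union>i\<in>{1..k}. F i) \<and> triangle_free (\<Union>i\<in>{1..k}. F i))"

context nests
begin

text \<open>
  Only the differences between the rotations matter: in \<open>spokes\<close>, \<open>d\<close> and \<open>d'\<close> are the rotations of
  the two spokes relative to that of the chord, and in \<open>around\<close>, \<open>d\<close>, \<open>d'\<close> and \<open>d''\<close>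
  are the differences between the rotations of the chords that meet at a corner of the triangle.
\<close>
lemma packable_rotations:
  assumes disjoint: "\<And>d s t. 0 < d \<Longrightarrow> d < k \<Longrightarrow> s \<in> centers \<Longrightarrow> t \<in> centers \<Longrightarrow>
      \<not> N dvd \<mu> * d + s - t"
    and spokes: "\<And>d d' p q. \<bar>d\<bar> < k \<Longrightarrow> \<bar>d'\<bar> < k \<Longrightarrow> \<bar>d - d'\<bar> < k \<Longrightarrow> (p, q) \<in> pairs \<Longrightarrow>
      N dvd \<mu> * d - p \<Longrightarrow> N dvd \<mu> * d' - q \<Longrightarrow> False"
    and around: "\<And>d d' d'' p q p' q' p'' q''. \<bar>d\<bar> < k \<Longrightarrow> \<bar>d'\<bar> < k \<Longrightarrow> \<bar>d''\<bar> < k \<Longrightarrow>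
      (p, q) \<in> pairs \<Longrightarrow> (p', q') \<in> pairs \<Longrightarrow> (p'', q'') \<in> pairs \<Longrightarrow>
      (q - p) + (q' - p') + (q'' - p'') = N \<Longrightarrow>
      N dvd \<mu> * d + q - p' \<Longrightarrow> N dvd \<mu> * d' + q' - p'' \<Longrightarrow> N dvd \<mu> * d'' + q'' - p \<Longrightarrow> False"
  shows "packable (if c = 0 then 2 else 3) k"
  unfolding packable_def
proof (intro exI [of _ "\<lambda>i. matching (\<mu> * i)"] conjI ballI impI)
  fix i assume "i \<in> {1..k}"
  show "perfect_matching points (matching (\<mu> * i))" by (rule matching_perfect)
  show "non_crossing (matching (\<mu> * i))" by (rule matching_non_crossing)
  show "card (matching (\<mu> * i) \<inter> {{rim e, rim (e + 1)} | e. True}) = (if c = 0 then 2 else 3)"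
    by (rule matching_boundary_edges)
next
  have *: "matching (\<mu> * i) \<inter> matching (\<mu> * j) = {}" if "1 \<le> j" "j < i" "i \<le> k" for i j
  proof (rule matchings_disjoint)
    fix s t assume "s \<in> centers" "t \<in> centers"
    then show "\<not> N dvd \<mu> * i - \<mu> * j + s - t"
      using disjoint [of "i - j" s t] that by (simp add: right_diff_distrib)
  qed
  fix i j assume "i \<in> {1..k}" "j \<in> {1..k}" "i \<noteq> j"
  then show "matching (\<mu> * i) \<inter> matching (\<mu> * j) = {}"
    using * [of j i] * [of i j] by (cases "j < i") auto
next
  have "(\<Union>i\<in>{1..k}. matching (\<mu> * i)) \<subseteq> segments points"
    using matching_perfect unfolding perfect_matching_def by blast
  then show "geometric_graph points (\<Union>i\<in>{1..k}. matching (\<mu> * i))"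
    unfolding geometric_graph_def using points_general_position by blast
next
  have "triangle_free (\<Union>i\<in>(\<lambda>i. \<mu> * i) ` {1..k}. matching i)"
  proof (rule triangle_free_union)
    fix i i' j p q
    assume "i \<in> (\<lambda>i. \<mu> * i) ` {1..k}" "i' \<in> (\<lambda>i. \<mu> * i) ` {1..k}" "j \<in> (\<lambda>i. \<mu> * i) ` {1..k}"
      and "(p, q) \<in> pairs" "N dvd i - (j + p)" "N dvd i' - (j + q)"
    moreover from this obtain u u' w where "i = \<mu> * u" "i' = \<mu> * u'" "j = \<mu> * w"
      "u \<in> {1..k}" "u' \<in> {1..k}" "w \<in> {1..k}" by blast
    moreover from this have "\<bar>u - w\<bar> < k" "\<bar>u' - w\<bar> < k" "\<bar>(u - w) - (u' - w)\<bar> < k"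
      by auto
    ultimately show False
      using spokes [of "u - w" "u' - w" p q] by (simp add: algebra_simps)
  next
    fix i i' i'' p q p' q' p'' q''
    assume "i \<in> (\<lambda>i. \<mu> * i) ` {1..k}" "i' \<in> (\<lambda>i. \<mu> * i) ` {1..k}" "i'' \<in> (\<lambda>i. \<mu> * i) ` {1..k}"
      and *: "(p, q) \<in> pairs" "(p', q') \<in> pairs" "(p'', q'') \<in> pairs"
        "(q - p) + (q' - p') + (q'' - p'') = N"
        "N dvd (i + q) - (i' + p')" "N dvd (i' + q') - (i'' + p'')" "N dvd (i'' + q'') - (i + p)"
    then obtain u u' u'' where u: "i = \<mu> * u" "i' = \<mu> * u'" "i'' = \<mu> * u''"
      "u \<in> {1..k}" "u' \<in> {1..k}" "u'' \<in> {1..k}" by blast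
    show False
    proof (rule around [OF _ _ _ *(1-4)])
      show "\<bar>u - u'\<bar> < k" "\<bar>u' - u''\<bar> < k" "\<bar>u'' - u\<bar> < k"
        using u by auto
      show "N dvd \<mu> * (u - u') + q - p'" "N dvd \<mu> * (u' - u'') + q' - p''"
        "N dvd \<mu> * (u'' - u) + q'' - p"
        using * u by (simp_all add: algebra_simps)
    qed
  qed
  then show "triangle_free (\<Union>i\<in>{1..k}. matching (\<mu> * i))"
    by (simp add: image_image)
qed

end

context wheel
begin

lemma small_multiples:
  assumes "N dvd m" "\<bar>m\<bar> < 2 * N"
  shows "m = 0 \<or> m = N \<or> m = - N"
proof -
  obtain h where h: "m = N * h" using assms(1) ..
  have N: "N > 0" using N_pos by simp
  have "N * h < N * 2" "N * (-2) < N * h" using assms(2) h by linarith+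
  then have "h < 2" "-2 < h" using N by (simp_all only: mult_less_cancel_left_pos)
  then have "h = 0 \<or> h = 1 \<or> h = -1" by linarith
  then show ?thesis using h by auto
qed

lemma no_small_odd_multiple:
  assumes "N dvd m" "odd m" "\<bar>m\<bar> < N"
  shows False
proof -
  have "m = 0" using small_multiples [OF assms(1)] assms(3) by linarith
  then show False using assms(2) by simp
qed

end

text \<open>
  With spokes at even positions, the length \<open>q - p\<close> of a chord between two spokes would be an odd
  number congruent to an even one; by the size bound, their difference is too small to be an odd
  multiple of \<open>N\<close>.
\<close>
lemma (in nests) no_chord_between_even_spokes:
  assumes "\<bar>d - d'\<bar> < k" "(p, q) \<in> pairs" "2 * k - 2 + (q - p) < N"
    and "N dvd 2 * d - p" "N dvd 2 * d' - q"
  shows False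
proof (rule no_small_odd_multiple)
  show "N dvd 2 * (d - d') + (q - p)"
    using dvd_diff [OF assms(4) assms(5)] by (simp add: algebra_simps)
  show "odd (2 * (d - d') + (q - p))"
    using pair_bounds(4) [OF assms(2)] by simp
  show "\<bar>2 * (d - d') + (q - p)\<bar> < N"
    using assms(1,3) pair_bounds(2) [OF assms(2)] by (smt (verit))
qed

text \<open>
  Two chords of equal length in rotations of the same nest that share an end are rotated against each
  other by their own length, which is odd; an even rotation achieves this only modulo \<open>N\<close>, and the
  size bound forbids that.
\<close>
lemma (in nests) no_even_turn_between_longest:
  assumes "(p, q) \<in> pairs" "\<bar>d\<bar> < k" "p + q = p' + q'" "q - p = q' - p'"
    and "2 * k - 2 + (q - p) < N" "N dvd 2 * d + q - p'"
  shows False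
proof (rule no_small_odd_multiple)
  have "p' = p" using assms by linarith
  then show "N dvd 2 * d + (q - p)" using assms(6) by (simp add: algebra_simps)
  show "odd (2 * d + (q - p))"
    using pair_bounds(4) [OF assms(1)] by simp
  show "\<bar>2 * d + (q - p)\<bar> < N"
    using assms(2,5) pair_bounds(2) [OF assms(1)] by (smt (verit))
qed

text \<open>
  Adjacent nest centres are \<open>a + b\<close> and \<open>b + c\<close> apart.  When these distances are odd, an even rotation
  changes them into odd numbers, which the size bounds keep below \<open>N\<close>; and it turns the distance
  \<open>a + 2 b + c\<close> of the outer centres into an even number below \<open>2 N\<close>, which is a multiple of \<open>N\<close>
  only if it vanishes, that is, if the rotation is as large as this distance.
\<close>
lemma (in nests) even_turns_disjoint:
  assumes odd: "odd (a + b)" "odd (b + c)"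
    and k: "2 * k - 2 + (a + b) < N" "2 * k - 2 + (b + c) < N" "2 * k - 2 < a + 2 * b + c"
    and d: "0 < d" "d < k" and st: "s \<in> centers" "t \<in> centers"
  shows "\<not> N dvd 2 * d + s - t"
proof
  assume "N dvd 2 * d + s - t"
  then have dvd: "N dvd 2 * d + (s - t)" by (simp add: algebra_simps)
  define e where "e = s - t"
  have "e \<in> {a + b, - (a + b), b + c, - (b + c)} \<or> e \<in> {0, a + 2 * b + c, - (a + 2 * b + c)}"
    using st unfolding centers_def e_def by (auto split: if_splits)
  then show False
  proof
    assume *: "e \<in> {a + b, - (a + b), b + c, - (b + c)}"
    then have "odd (2 * d + e)" using odd by auto
    moreover have "\<bar>2 * d + e\<bar> < N"
      using * d k size_pos by auto
    ultimately show False
      using no_small_odd_multiple dvd unfolding e_def by blast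
  next
    assume *: "e \<in> {0, a + 2 * b + c, - (a + 2 * b + c)}"
    have "even (a + 2 * b + c)" using odd by simp
    then have "even (2 * d + e)" using * by auto
    moreover have "odd N" by (simp add: N_def)
    ultimately have "2 * d + e \<noteq> N" "2 * d + e \<noteq> - N"
      by (metis even_minus)+
    moreover have "2 * d + e \<noteq> 0" "\<bar>2 * d + e\<bar> < 2 * N"
      using * d k size_pos size_sum size_le N_def by auto
    ultimately show False
      using small_multiples dvd unfolding e_def by blast
  qed
qed

context wheel
begin

text \<open>
  The sizes \<open>h\<close> and \<open>g\<close> are the two halves of \<open>n - 1\<close>, rounded up and down.  Of three chords surrounding
  the centre, two lie in rotations of the same nest; as the third has length at most \<open>2 h - 1\<close>, these
  two are turned against each other by at least \<open>(N - (2 h - 1)) / 2 = g + 1\<close> steps, which is more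
  than \<open>k\<close> consecutive rotations allow.
\<close>
lemma packable_two:
  assumes "n = h + g + 1" "g \<le> h" "h \<le> g + 1" "g > 0" "k \<le> g + 1"
  shows "packable 2 k"
proof -
  interpret nests n x r \<theta> h g 0
    by unfold_locales (use assms in auto)
  have N: "N = 2 * h + 2 * g + 1" using assms(1) unfolding N_def by simp
  have short: "q - p \<le> 2 * h - 1" if "(p, q) \<in> pairs" for p q
    using that assms unfolding nested_pairs_def by auto
  have nest: "p + q = 2 * h + 1 \<or> 2 * h < p \<and> p + q = 4 * h + 2 * g + 1" if "(p, q) \<in> pairs" for p q
    using that unfolding nested_pairs_def by auto
  have same: False
    if "\<bar>d\<bar> < k" "(p, q) \<in> pairs" "(p', q') \<in> pairs" "(p'', q'') \<in> pairs" "p + q = p' + q'"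
      "(q - p) + (q' - p') + (q'' - p'') = N" "N dvd 1 * d + q - p'" for d p q p' q' p'' q''
  proof -
    \<comment> \<open>In one nest, the turn from one chord to the next is the mean of their lengths.\<close>
    have "2 * q - 2 * p' = N - (q'' - p'')" using that by linarith
    then have "g + 1 \<le> q - p'" "2 * q - 2 * p' < N"
      using short [OF that(4)] pair_bounds(2) [OF that(4)] N by linarith+
    then have "0 < 1 * d + q - p'" "1 * d + q - p' < N"
      using \<open>\<bar>d\<bar> < k\<close> assms N by linarith+
    then show False using that(7) zdvd_not_zless by blast
  qed
  have "packable (if (0::int) = 0 then 2 else 3) k"
  proof (rule packable_rotations [where \<mu> = 1])
    fix d s t assume "0 < d" "d < k" "s \<in> centers" "t \<in> centers"
    then have "0 < \<bar>1 * d + s - t\<bar> \<and> \<bar>1 * d + s - t\<bar> < N"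
      using assms N unfolding centers_def by auto
    then show "\<not> N dvd 1 * d + s - t"
      using dvd_imp_le_int [of "1 * d + s - t" N] by linarith
  next
    fix d d' p q
    assume d: "\<bar>d\<bar> < k" "\<bar>d'\<bar> < k" "\<bar>d - d'\<bar> < k" and pq: "(p, q) \<in> pairs"
      and dvd: "N dvd 1 * d - p" "N dvd 1 * d' - q"
    note b = pair_bounds [OF pq]
    have half: "2 * q - 2 * p < N" using b(5) by simp
    have "d - p < N" "- (2 * N) < d - p" "d' - q < N" "- (2 * N) < d' - q"
      using d(1,2) b(1,2,3) assms N by linarith+
    then have p: "p = d \<or> p = d + N" and q: "q = d' \<or> q = d' + N"
      using small_multiples [OF dvd(1)] small_multiples [OF dvd(2)] by (smt (verit))+
    \<comment> \<open>The ends of the spokes fill an arc of \<open>k\<close> points, so a chord between two of them has both ends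
      near position \<open>0\<close> or both near \<open>N\<close>, off centre in its nest.\<close>
    have "p + q < 2 * h + 1" if "p = d"
      using q that d half assms N by (elim disjE) linarith+
    moreover have "p + q > 4 * h + 2 * g + 1" if "p = d + N"
      using q that d b(1-3) assms N by (elim disjE) linarith+
    moreover have "\<not> 2 * h < p" if "p = d"
      using that d assms by linarith
    ultimately show False
      using nest [OF pq] p b(1) assms by auto
  next
    fix d d' d'' p q p' q' p'' q''
    assume d: "\<bar>d\<bar> < k" "\<bar>d'\<bar> < k" "\<bar>d''\<bar> < k"
      and pairs: "(p, q) \<in> pairs" "(p', q') \<in> pairs" "(p'', q'') \<in> pairs"
      and sum: "(q - p) + (q' - p') + (q'' - p'') = N"
      and dvd: "N dvd 1 * d + q - p'" "N dvd 1 * d' + q' - p''" "N dvd 1 * d'' + q'' - p"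
    have "p + q = p' + q' \<or> p' + q' = p'' + q'' \<or> p'' + q'' = p + q"
      using nest [OF pairs(1)] nest [OF pairs(2)] nest [OF pairs(3)] by linarith
    moreover have "(q' - p') + (q'' - p'') + (q - p) = N" "(q'' - p'') + (q - p) + (q' - p') = N"
      using sum by linarith+
    ultimately show False
      using same [OF d(1) pairs(1,2,3) _ sum dvd(1)]
        same [OF d(2) pairs(2,3,1) _ _ dvd(2)] same [OF d(3) pairs(3,1,2) _ _ dvd(3)]
      by blast
  qed
  then show ?thesis by simp
qed

text \<open>
  Three lengths of at most \<open>2 t - 1\<close> add up to less than \<open>N = 6 t - 1\<close>.
\<close>
lemma packable_three_0:
  assumes n: "n = 3 * t" and t: "t \<ge> 2" and k: "k \<le> 2 * t - 1"
  shows "packable 3 k"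
proof -
  interpret nests n x r \<theta> t "t - 1" t
    by unfold_locales (use assms in auto)
  have N: "N = 6 * t - 1" using n unfolding N_def by simp
  have short: "q - p \<le> 2 * t - 1" if "(p, q) \<in> pairs" for p q
    using that t unfolding nested_pairs_def by auto
  have "packable (if t = 0 then 2 else 3) k"
  proof (rule packable_rotations [where \<mu> = 2])
    fix d s u assume "0 < d" "d < k" "s \<in> centers" "u \<in> centers"
    then show "\<not> N dvd 2 * d + s - u"
      using t k N by (intro even_turns_disjoint [where k = k]) simp_all
  next
    fix d d' p q
    assume d: "\<bar>d - d'\<bar> < k" and pq: "(p, q) \<in> pairs"
      and dvd: "N dvd 2 * d - p" "N dvd 2 * d' - q"
    have "2 * k - 2 + (q - p) < N"
      using short [OF pq] k N by linarith
    then show False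
      by (rule no_chord_between_even_spokes [OF d pq _ dvd])
  next
    fix p q p' q' p'' q''
    assume pairs: "(p, q) \<in> pairs" "(p', q') \<in> pairs" "(p'', q'') \<in> pairs"
      and sum: "(q - p) + (q' - p') + (q'' - p'') = N"
    show False
      using short [OF pairs(1)] short [OF pairs(2)] short [OF pairs(3)] sum N by linarith
  qed
  then show ?thesis using t by simp
qed

text \<open>
  The sum \<open>N = 6 t + 1\<close> requires two chords of length \<open>2 t + 1\<close>, and these occur only in the
  third nest.
\<close>
lemma packable_three_1:
  assumes n: "n = 3 * t + 1" and t: "t \<ge> 2" and k: "k \<le> 2 * t"
  shows "packable 3 k"
proof -
  interpret nests n x r \<theta> "t - 1" t "t + 1"
    by unfold_locales (use assms in auto)
  have N: "N = 6 * t + 1" using n unfolding N_def by simp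
  have short: "q - p \<le> 2 * t - 1 \<or> q - p \<le> 2 * t + 1 \<and> p + q = 10 * t - 1"
    if "(p, q) \<in> pairs" for p q
    using that t unfolding nested_pairs_def by auto
  have "packable (if t + 1 = 0 then 2 else 3) k"
  proof (rule packable_rotations [where \<mu> = 2])
    fix d s u assume "0 < d" "d < k" "s \<in> centers" "u \<in> centers"
    then show "\<not> N dvd 2 * d + s - u"
      using t k N by (intro even_turns_disjoint [where k = k]) simp_all
  next
    fix d d' p q
    assume d: "\<bar>d - d'\<bar> < k" and pq: "(p, q) \<in> pairs"
      and dvd: "N dvd 2 * d - p" "N dvd 2 * d' - q"
    have "2 * k - 2 + (q - p) < N"
      using short [OF pq] k N by linarith
    then show False
      by (rule no_chord_between_even_spokes [OF d pq _ dvd])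
  next
    fix d d' d'' p q p' q' p'' q''
    assume d: "\<bar>d\<bar> < k" "\<bar>d'\<bar> < k" "\<bar>d''\<bar> < k"
      and pairs: "(p, q) \<in> pairs" "(p', q') \<in> pairs" "(p'', q'') \<in> pairs"
      and sum: "(q - p) + (q' - p') + (q'' - p'') = N"
      and dvd: "N dvd 2 * d + q - p'" "N dvd 2 * d' + q' - p''" "N dvd 2 * d'' + q'' - p"
    have odd: "odd (q - p)" "odd (q' - p')" "odd (q'' - p'')"
      using pairs pair_bounds(4) by blast+
    have long: False if "\<bar>d\<bar> < k" "(p, q) \<in> pairs" "(p', q') \<in> pairs"
      "q - p = 2 * t + 1" "q' - p' = 2 * t + 1" "N dvd 2 * d + q - p'" for d p q p' q'
    proof (rule no_even_turn_between_longest [OF that(2,1) _ _ _ that(6)])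
      show "p + q = p' + q'" using short [OF that(2)] short [OF that(3)] that by linarith
      show "2 * k - 2 + (q - p) < N" using that k N by linarith
    qed (use that in simp)
    have "q - p = 2 * t + 1 \<or> q - p \<le> 2 * t - 1" "q' - p' = 2 * t + 1 \<or> q' - p' \<le> 2 * t - 1"
      "q'' - p'' = 2 * t + 1 \<or> q'' - p'' \<le> 2 * t - 1"
      using odd short [OF pairs(1)] short [OF pairs(2)] short [OF pairs(3)] by presburger+
    then have "q - p = 2 * t + 1 \<and> q' - p' = 2 * t + 1 \<or> q' - p' = 2 * t + 1 \<and> q'' - p'' = 2 * t + 1
        \<or> q'' - p'' = 2 * t + 1 \<and> q - p = 2 * t + 1"
      using sum N by linarith
    then show False
      using long [OF d(1) pairs(1,2) _ _ dvd(1)] long [OF d(2) pairs(2,3) _ _ dvd(2)]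
        long [OF d(3) pairs(3,1) _ _ dvd(3)] by blast
  qed
  then show ?thesis using t by simp
qed

text \<open>
  The sum \<open>N = 6 t + 3\<close> requires all three chords to have length \<open>2 t + 1\<close>, and these occur only in the
  second nest.
\<close>
lemma packable_three_2:
  assumes n: "n = 3 * t + 2" and t: "t \<ge> 1" and k: "k \<le> 2 * t + 1"
  shows "packable 3 k"
proof -
  interpret nests n x r \<theta> t "t + 1" t
    by unfold_locales (use assms in auto)
  have N: "N = 6 * t + 3" using n unfolding N_def by simp
  have short: "q - p \<le> 2 * t - 1 \<or> q - p \<le> 2 * t + 1 \<and> p + q = 6 * t + 3"
    if "(p, q) \<in> pairs" for p q
    using that t unfolding nested_pairs_def by auto
  have "packable (if t = 0 then 2 else 3) k"
  proof (rule packable_rotations [where \<mu> = 2])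
    fix d s u assume "0 < d" "d < k" "s \<in> centers" "u \<in> centers"
    then show "\<not> N dvd 2 * d + s - u"
      using t k N by (intro even_turns_disjoint [where k = k]) simp_all
  next
    fix d d' p q
    assume d: "\<bar>d - d'\<bar> < k" and pq: "(p, q) \<in> pairs"
      and dvd: "N dvd 2 * d - p" "N dvd 2 * d' - q"
    have "2 * k - 2 + (q - p) < N"
      using short [OF pq] k N by linarith
    then show False
      by (rule no_chord_between_even_spokes [OF d pq _ dvd])
  next
    fix d p q p' q' p'' q''
    assume d: "\<bar>d\<bar> < k" and pairs: "(p, q) \<in> pairs" "(p', q') \<in> pairs" "(p'', q'') \<in> pairs"
      and sum: "(q - p) + (q' - p') + (q'' - p'') = N" and dvd: "N dvd 2 * d + q - p'"
    note * = short [OF pairs(1)] short [OF pairs(2)] short [OF pairs(3)] sum N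
    show False
    proof (rule no_even_turn_between_longest [OF pairs(1) d _ _ _ dvd])
      show "p + q = p' + q'" "q - p = q' - p'" using * by linarith+
      show "2 * k - 2 + (q - p) < N" using * k by linarith
    qed
  qed
  then show ?thesis using t by simp
qed

end

section \<open>Regular wheel configurations\<close>

lemma regular_wheel_packable:
  assumes wheel: "regular_wheel (2 * n) S x v" and n: "n \<ge> 3"
    and packable: "\<And>r \<theta>. wheel (int n) r \<Longrightarrow> wheel.packable (int n) x r \<theta> b (int k)"
  shows "\<exists>F :: nat \<Rightarrow> complex set set.
           (\<forall>i\<in>{1..k}. perfect_matching S (F i) \<and> non_crossing (F i) \<and>
                        card (F i \<inter> boundary_edges (2 * n) v) = b) \<and>
           (\<forall>i\<in>{1..k}. \<forall>j\<in>{1..k}. i \<noteq> j \<longrightarrow> F i \<inter> F j = {}) \<and>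
           geometric_graph S (\<Union>i\<in>{1..k}. F i) \<and>
           triangle_free (\<Union>i\<in>{1..k}. F i)"
proof -
  obtain r \<theta> where r: "r > 0"
    and v: "\<And>i. i < 2 * n - 1 \<Longrightarrow> v i = x + of_real r * cis (\<theta> + 2 * pi * real i / real (2 * n - 1))"
    and S: "S = insert x (v ` {..<2 * n - 1})"
    using wheel unfolding regular_wheel_def by auto
  interpret wheel "int n" x r \<theta>
    by unfold_locales (use n r in auto)
  have N: "N = int (2 * n - 1)" using n by (simp add: N_def of_nat_diff)
  have v_rim: "v i = rim (int i)" if "i < 2 * n - 1" for i
    using v [OF that] unfolding rim_def N by simp
  have rim_v: "rim e = v (nat (e mod N))" "nat (e mod N) < 2 * n - 1" for e
  proof -
    have "0 \<le> e mod N" "e mod N < N" using n N by simp_all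
    then show "nat (e mod N) < 2 * n - 1" using N by linarith
    then show "rim e = v (nat (e mod N))"
      using v_rim \<open>0 \<le> e mod N\<close> rim_mod by simp
  qed
  have "v ` {..<2 * n - 1} = range rim"
  proof (intro equalityI subsetI)
    fix z assume "z \<in> range rim"
    then obtain e where "z = rim e" by auto
    then show "z \<in> v ` {..<2 * n - 1}"
      using rim_v [of e] by blast
  next
    fix z assume "z \<in> v ` {..<2 * n - 1}"
    then show "z \<in> range rim" using v_rim by auto
  qed
  then have points: "S = points" using S by simp
  have v_Suc: "v (Suc i mod (2 * n - 1)) = rim (int i + 1)" if "i < 2 * n - 1" for i
  proof -
    have "Suc i mod (2 * n - 1) < 2 * n - 1" using n by simp
    then have "v (Suc i mod (2 * n - 1)) = rim (int (Suc i mod (2 * n - 1)))" by (rule v_rim)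
    also have "int (Suc i mod (2 * n - 1)) = (int i + 1) mod N"
      unfolding N by (simp add: zmod_int add.commute)
    finally show ?thesis by (simp add: rim_mod)
  qed
  have boundary: "boundary_edges (2 * n) v = {{rim e, rim (e + 1)} | e. True}"
  proof (intro equalityI subsetI)
    fix f assume "f \<in> boundary_edges (2 * n) v"
    then show "f \<in> {{rim e, rim (e + 1)} | e. True}"
      unfolding boundary_edges_def using v_rim v_Suc by auto
  next
    fix f assume "f \<in> {{rim e, rim (e + 1)} | e. True}"
    then obtain e where f: "f = {rim e, rim (e + 1)}" by auto
    let ?i = "nat (e mod N)"
    have "rim (int ?i + 1) = rim (e + 1)"
      using n N unfolding rim_eq_iff by (simp add: mod_eq_dvd_iff [symmetric])
    then have "f = {v ?i, v (Suc ?i mod (2 * n - 1))}"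
      using f rim_v [of e] v_Suc [of ?i] by simp
    then show "f \<in> boundary_edges (2 * n) v"
      unfolding boundary_edges_def using rim_v(2) [of e] by auto
  qed
  obtain G where G:
    "\<forall>i\<in>{1..int k}. perfect_matching points (G i) \<and> non_crossing (G i) \<and>
        card (G i \<inter> {{rim e, rim (e + 1)} | e. True}) = b"
    "\<forall>i\<in>{1..int k}. \<forall>j\<in>{1..int k}. i \<noteq> j \<longrightarrow> G i \<inter> G j = {}"
    "geometric_graph points (\<Union>i\<in>{1..int k}. G i)" "triangle_free (\<Union>i\<in>{1..int k}. G i)"
    using packable [OF wheel_axioms, of \<theta>] unfolding packable_def by blast
  have "{1..int k} = int ` {1..k}"
    by (simp add: image_int_atLeastAtMost)
  then have union: "(\<Union>i\<in>{1..int k}. G i) = (\<Union>i\<in>{1..k}. G (int i))"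
    by (simp add: image_image)
  show ?thesis
    by (rule exI [of _ "\<lambda>i. G (int i)"]) (use G in \<open>simp add: points boundary union\<close>)
qed

theorem theorem2:
  fixes b n k :: nat and S :: "complex set" and x :: complex and v :: "nat \<Rightarrow> complex"
  assumes "b \<in> {2, 3}"
    and "n \<ge> b\<^sup>2 - 1"
    and "regular_wheel (2 * n) S x v"
    and "k > 0"
    and "int k \<le> \<lceil>(real b - 1) * real n / real b\<rceil> - (int b - 2)"
  shows "\<exists>F :: nat \<Rightarrow> complex set set.
           (\<forall>i\<in>{1..k}. perfect_matching S (F i) \<and> non_crossing (F i) \<and>
                        card (F i \<inter> boundary_edges (2 * n) v) = b) \<and>
           (\<forall>i\<in>{1..k}. \<forall>j\<in>{1..k}. i \<noteq> j \<longrightarrow> F i \<inter> F j = {}) \<and>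
           geometric_graph S (\<Union>i\<in>{1..k}. F i) \<and>
           triangle_free (\<Union>i\<in>{1..k}. F i)"
proof (rule regular_wheel_packable [OF assms(3)])
  show "n \<ge> 3" using assms(1,2) by auto
  fix r \<theta> assume "wheel (int n) r"
  then interpret wheel "int n" x r \<theta> .
  \<comment> \<open>The bound with the ceiling removed: \<open>2 k < n + 2\<close> for \<open>b = 2\<close> and \<open>3 k < 2 n\<close> for \<open>b = 3\<close>.\<close>
  have "of_int (int k + int b - 2) < (real b - 1) * real n / real b + 1"
    using assms(5) by linarith
  then have k: "real b * (real k + real b - 3) < (real b - 1) * real n"
    using assms(1) by (auto simp: field_simps)
  show "packable b (int k)"
  proof (cases "b = 2")
    case True
    then have "2 * int k < int n + 2" using k by simp
    then show ?thesis
      using True packable_two [of "int n div 2" "int n - 1 - int n div 2" "int k"] n_ge by simp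
  next
    case False
    then have b: "b = 3" using assms(1) by simp
    then have "3 * int k < 2 * int n" using k by simp
    moreover have "n \<ge> 8" using b assms(2) by simp
    moreover define t where "t = int n div 3"
    ultimately have t: "t \<ge> 2" and kt: "3 * int k < 2 * int n" by simp_all
    have "int n = 3 * t \<or> int n = 3 * t + 1 \<or> int n = 3 * t + 2"
      unfolding t_def by linarith
    then have "packable 3 (int k)"
    proof (elim disjE)
      assume n: "int n = 3 * t"
      then show "packable 3 (int k)" using kt t by (intro packable_three_0 [OF n]) auto
    next
      assume n: "int n = 3 * t + 1"
      then show "packable 3 (int k)" using kt t by (intro packable_three_1 [OF n]) auto
    next
      assume n: "int n = 3 * t + 2"
      then show "packable 3 (int k)" using kt t by (intro packable_three_2 [OF n]) auto
    qed
    then show ?thesis using b by simp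
  qed
qed

end
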